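(* Let $\mathcal{P}$ be a finite set of price vectors, let $\mathcal{U}$ be a convex set, and suppose that $R(\mathbf{p},\mathbf{u})$ is convex in $\mathbf{u}\in\mathcal{U}$ for every $\mathbf{p}\in\mathcal{P}$. Then $$\max_{\boldsymbol{\pi}\in\Delta_{\mathcal{P}}} \min_{\mathbf{u}\in\mathcal{U}} \sum_{\mathbf{p}\in\mathcal{P}} \pi_{\mathbf{p}} R(\mathbf{p},\mathbf{u}) = \min_{\mathbf{u}\in\mathcal{U}} \max_{\mathbf{p}\in\mathcal{P}} R(\mathbf{p},\mathbf{u}),$$ and the common value is the optimal value of the problem of minimizing $t$ over $(t,\mathbf{u})\in\mathbb{R}\times\mathcal{U}$ subject to $t\ge R(\mathbf{p},\mathbf{u})$ for all $\mathbf{p}\in\mathcal{P}$.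
   Context: $\mathcal{P}\subseteq\mathbb{R}_+^I$ is (nonempty and) finite, $\mathcal{U}\subseteq\mathbb{R}^M$ is (nonempty and) convex, $R:\mathcal{P}\times\mathcal{U}\to\mathbb{R}$ is the revenue function, and $\Delta_{\mathcal{P}} = \{\boldsymbol{\pi}\in\mathbb{R}^{\mathcal{P}} : \sum_{\mathbf{p}\in\mathcal{P}}\pi_{\mathbf{p}}=1,\ \pi_{\mathbf{p}}\ge 0\ \forall \mathbf{p}\in\mathcal{P}\}$. Here $\max$ and $\min$ denote optimal values (supremum and infimum). *)

theory Defs
  imports "HOL-Analysis.Analysis"
begin

text \<open>Elements of \<open>\<real>\<^sup>P\<close> are functions that are \<open>undefined\<close> outside of \<open>P\<close>.\<close>

definition prob_simplex :: "'a set \<Rightarrow> ('a \<Rightarrow> real) set" where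
  "prob_simplex P = {\<pi> \<in> P \<rightarrow>\<^sub>E UNIV. (\<Sum>p\<in>P. \<pi> p) = 1 \<and> (\<forall>p\<in>P. 0 \<le> \<pi> p)}"

end

theory Submission
  imports Defs
begin

text \<open>
  The inequality \<open>\<le>\<close> holds because a weighted mean is at most the maximum. For the converse it
  suffices to show: if the maximum of finitely many convex functions is at least \<open>c\<close> on \<open>U\<close>, then so
  is one of their convex combinations. For two functions \<open>a\<close> and \<open>b\<close>, separate the origin of the
  plane from the convex set of points that strictly dominate some \<open>(a u - c, b u - c)\<close>: this set is
  closed upwards, so the separating functional is nonnegative. The general case follows by
  induction. Combine a new function \<open>q\<close> with the maximum \<open>M\<close> of the others, which is again convex;
  then \<open>l q + (1 - l) M\<close> is the maximum of the functions \<open>l q + (1 - l) f\<close>, to which the induction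
  hypothesis applies.
\<close>

lemma convex_on_Max:
  fixes f :: "'a \<Rightarrow> 'v::real_vector \<Rightarrow> real"
  assumes "finite P" "P \<noteq> {}" and convex: "\<And>p. p \<in> P \<Longrightarrow> convex_on U (f p)"
  shows "convex_on U (\<lambda>u. MAX p\<in>P. f p u)"
proof -
  have "epigraph U (\<lambda>u. MAX p\<in>P. f p u) = (\<Inter>p\<in>P. epigraph U (f p))"
    using assms(1,2) by (auto simp: epigraph_def)
  moreover have "convex (\<Inter>p\<in>P. epigraph U (f p))"
    by (intro convex_INT convex_epigraphI convex)
  ultimately show ?thesis by (simp add: convex_epigraph_convex)
qed

lemma convex_strict_dominators:
  fixes a b :: "'v::real_vector \<Rightarrow> real"
  assumes a: "convex_on U a" and b: "convex_on U b"
  shows "convex {z. \<exists>u\<in>U. a u < fst z \<and> b u < snd z}" (is "convex ?C")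
proof (rule convexI)
  fix y z and s t :: real
  assume "y \<in> ?C" "z \<in> ?C" and st: "0 \<le> s" "0 \<le> t" "s + t = 1"
  then obtain u v where u: "u \<in> U" "a u < fst y" "b u < snd y"
    and v: "v \<in> U" "a v < fst z" "b v < snd z"
    by blast
  have combine: "f (s *\<^sub>R u + t *\<^sub>R v) < s * x + t * x'"
    if f: "convex_on U f" and "f u < x" "f v < x'" for f x x'
  proof -
    have "f (s *\<^sub>R u + t *\<^sub>R v) \<le> s * f u + t * f v"
      using f u(1) v(1) st by (simp add: convex_on_def)
    also have "\<dots> < s * x + t * x'"
      using convex_bound_lt[of "f u - x" 0 "f v - x'" s t] that st by (simp add: algebra_simps)
    finally show ?thesis .
  qed
  have "s *\<^sub>R u + t *\<^sub>R v \<in> U"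
    using convex_on_imp_convex[OF a] u(1) v(1) st by (simp add: convexD)
  with combine[OF a u(2) v(2)] combine[OF b u(3) v(3)] show "s *\<^sub>R y + t *\<^sub>R z \<in> ?C"
    by auto
qed

lemma separating_hyperplane_set_0_up_closed:
  fixes C :: "'a::ordered_euclidean_space set"
  assumes "convex C" "C \<noteq> {}" "0 \<notin> C" and up_closed: "\<And>x y. x \<in> C \<Longrightarrow> x \<le> y \<Longrightarrow> y \<in> C"
  obtains w where "0 \<le> w" "w \<noteq> 0" "\<And>x. x \<in> C \<Longrightarrow> 0 \<le> w \<bullet> x"
proof -
  obtain w where "w \<noteq> 0" and w: "\<And>x. x \<in> C \<Longrightarrow> 0 \<le> w \<bullet> x"
    using separating_hyperplane_set_0[OF assms(1,3)] by blast
  obtain x where "x \<in> C" using \<open>C \<noteq> {}\<close> by blast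
  have "0 \<le> w \<bullet> i" if i: "i \<in> Basis" for i
  proof (rule ccontr)
    assume neg: "\<not> 0 \<le> w \<bullet> i"
    define t where "t = - (w \<bullet> x + 1) / (w \<bullet> i)"
    have "0 \<le> t" using w[OF \<open>x \<in> C\<close>] neg by (simp add: t_def divide_simps)
    then have "x \<le> x + t *\<^sub>R i"
      using i by (auto simp: eucl_le[where 'a='a] inner_left_distrib inner_Basis)
    then have "0 \<le> w \<bullet> (x + t *\<^sub>R i)" using up_closed \<open>x \<in> C\<close> w by blast
    also have "\<dots> = -1" using neg by (simp add: t_def inner_right_distrib)
    finally show False by simp
  qed
  then have "0 \<le> w" by (simp add: eucl_le[where 'a='a])
  then show thesis using \<open>w \<noteq> 0\<close> w by (rule that)
qed

lemma convex_on_max_ge_imp_combination_ge: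
  fixes a b :: "'v::real_vector \<Rightarrow> real"
  assumes a: "convex_on U a" and b: "convex_on U b" and "U \<noteq> {}"
    and max_ge: "\<And>u. u \<in> U \<Longrightarrow> c \<le> max (a u) (b u)"
  obtains l where "0 \<le> l" "l \<le> 1" "\<And>u. u \<in> U \<Longrightarrow> c \<le> l * a u + (1 - l) * b u"
proof -
  define C where "C = {z. \<exists>u\<in>U. a u - c < fst z \<and> b u - c < snd z}"
  have "convex_on U (\<lambda>u. f u - c)" if "convex_on U f" for f
    using convex_on_add[OF that, of "\<lambda>_. - c"] convex_on_imp_convex[OF that]
    by (simp add: convex_on_const)
  then have "convex C"
    unfolding C_def using a b by (intro convex_strict_dominators)
  moreover have mem_C: "(a u - c + e, b u - c + e) \<in> C" if "u \<in> U" "0 < e" for u e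
    using that unfolding C_def by (auto intro: bexI[of _ u])
  then have "C \<noteq> {}" using \<open>U \<noteq> {}\<close> zero_less_one by blast
  moreover have "0 \<notin> C" using max_ge by (fastforce simp: C_def)
  moreover have "z \<in> C" if "y \<in> C" "y \<le> z" for y z
    using that unfolding C_def less_eq_prod_def by (blast intro: less_le_trans)
  ultimately obtain w where "0 \<le> w" "w \<noteq> 0" and w: "\<And>z. z \<in> C \<Longrightarrow> 0 \<le> w \<bullet> z"
    using separating_hyperplane_set_0_up_closed[of C] by metis
  then have nonneg: "0 \<le> fst w" "0 \<le> snd w" and pos: "0 < fst w + snd w"
    by (auto simp: less_eq_prod_def prod_eq_iff)
  define k l where "k = fst w + snd w" and "l = fst w / k"
  have w_eq: "fst w = k * l" "snd w = k * (1 - l)"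
    using pos by (simp_all add: k_def l_def right_diff_distrib)
  show thesis
  proof
    show "0 \<le> l" "l \<le> 1" using nonneg pos by (simp_all add: k_def l_def)
    fix u assume "u \<in> U"
    show "c \<le> l * a u + (1 - l) * b u"
    proof (rule field_le_epsilon)
      fix e :: real assume "0 < e"
      then have "0 \<le> fst w * (a u - c + e) + snd w * (b u - c + e)"
        using w[OF mem_C[OF \<open>u \<in> U\<close>]] by (simp add: inner_prod_def)
      also have "\<dots> = k * (l * a u + (1 - l) * b u + e - c)"
        unfolding w_eq by (simp add: algebra_simps)
      finally show "c \<le> l * a u + (1 - l) * b u + e"
        using pos by (simp add: k_def zero_le_mult_iff)
    qed
  qed
qed

lemma prob_simplex_insert_combination:
  assumes "finite P" "q \<notin> P" "0 \<le> l" "l \<le> 1" and \<pi>: "\<pi> \<in> prob_simplex P"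
  obtains \<rho> where "\<rho> \<in> prob_simplex (insert q P)"
    "\<And>h. (\<Sum>p\<in>insert q P. \<rho> p * h p) = l * h q + (1 - l) * (\<Sum>p\<in>P. \<pi> p * h p)"
proof -
  define \<rho> where "\<rho> = (\<lambda>p\<in>P. (1 - l) * \<pi> p)(q := l)"
  have sum_\<rho>: "(\<Sum>p\<in>insert q P. \<rho> p * h p) = l * h q + (1 - l) * (\<Sum>p\<in>P. \<pi> p * h p)" for h
  proof -
    have "(\<Sum>p\<in>P. \<rho> p * h p) = (\<Sum>p\<in>P. (1 - l) * (\<pi> p * h p))"
      using assms(2) by (intro sum.cong) (auto simp: \<rho>_def)
    with assms(1,2) show ?thesis by (simp add: \<rho>_def sum_distrib_left)
  qed
  have "sum \<rho> (insert q P) = 1"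
    using sum_\<rho>[of "\<lambda>_. 1"] \<pi> by (simp add: prob_simplex_def)
  then have "\<rho> \<in> prob_simplex (insert q P)"
    using assms by (auto simp: prob_simplex_def \<rho>_def)
  then show thesis using sum_\<rho> by (rule that)
qed

lemma Max_affine:
  fixes f :: "'a \<Rightarrow> 'b::linordered_idom"
  assumes "finite P" "P \<noteq> {}" "0 \<le> k"
  shows "(MAX p\<in>P. d + k * f p) = d + k * (MAX p\<in>P. f p)"
proof -
  have "mono (\<lambda>x. d + k * x)"
    using assms(3) by (intro monoI add_left_mono mult_left_mono)
  from mono_Max_commute[OF this, of "f ` P"] show ?thesis
    using assms(1,2) by (simp add: image_image)
qed

lemma sum_prob_simplex_le_Max:
  assumes "finite P" and \<pi>: "\<pi> \<in> prob_simplex P"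
  shows "(\<Sum>p\<in>P. \<pi> p * f p) \<le> (MAX p\<in>P. f p)"
proof -
  have "(\<Sum>p\<in>P. \<pi> p * f p) \<le> (\<Sum>p\<in>P. \<pi> p * (MAX p\<in>P. f p))"
    using assms by (intro sum_mono mult_left_mono) (auto simp: prob_simplex_def)
  also have "\<dots> = (MAX p\<in>P. f p)"
    using \<pi> by (simp add: prob_simplex_def flip: sum_distrib_right)
  finally show ?thesis .
qed

lemma convex_on_Max_ge_imp_prob_simplex_ge:
  fixes f :: "'a \<Rightarrow> 'v::real_vector \<Rightarrow> real"
  assumes "finite P" "P \<noteq> {}" "U \<noteq> {}" "\<And>p. p \<in> P \<Longrightarrow> convex_on U (f p)"
    and "\<And>u. u \<in> U \<Longrightarrow> c \<le> (MAX p\<in>P. f p u)"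
  shows "\<exists>\<pi>\<in>prob_simplex P. \<forall>u\<in>U. c \<le> (\<Sum>p\<in>P. \<pi> p * f p u)"
  using assms
proof (induction P arbitrary: f rule: finite_ne_induct)
  case (singleton q)
  then show ?case by (intro bexI[of _ "\<lambda>p\<in>{q}. 1"]) (auto simp: prob_simplex_def)
next
  case (insert q P)
  note [simp] = \<open>finite P\<close> \<open>P \<noteq> {}\<close> \<open>q \<notin> P\<close>
  have convex_q: "convex_on U (f q)" and convex_P: "\<And>p. p \<in> P \<Longrightarrow> convex_on U (f p)"
    using insert.prems(2) by auto
  have "convex_on U (\<lambda>u. MAX p\<in>P. f p u)"
    using convex_P by (intro convex_on_Max) simp_all
  moreover have "c \<le> max (f q u) (MAX p\<in>P. f p u)" if "u \<in> U" for u
    using insert.prems(3)[OF that] by simp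
  ultimately obtain l where l: "0 \<le> l" "l \<le> 1"
    and combination_ge: "\<And>u. u \<in> U \<Longrightarrow> c \<le> l * f q u + (1 - l) * (MAX p\<in>P. f p u)"
    using convex_on_max_ge_imp_combination_ge[OF convex_q _ \<open>U \<noteq> {}\<close>] by blast
  define g where "g p u = l * f q u + (1 - l) * f p u" for p u
  have "convex_on U (g p)" if "p \<in> P" for p
    unfolding g_def using convex_q convex_P[OF that] l
    by (intro convex_on_add convex_on_cmul) simp_all
  moreover have "c \<le> (MAX p\<in>P. g p u)" if "u \<in> U" for u
    using combination_ge[OF that] l by (simp add: g_def Max_affine)
  ultimately obtain \<pi> where \<pi>: "\<pi> \<in> prob_simplex P"
    and mean_ge: "\<And>u. u \<in> U \<Longrightarrow> c \<le> (\<Sum>p\<in>P. \<pi> p * g p u)"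
    using insert.IH[OF \<open>U \<noteq> {}\<close>] by blast
  obtain \<rho> where \<rho>: "\<rho> \<in> prob_simplex (insert q P)"
    and sum_\<rho>: "\<And>h. (\<Sum>p\<in>insert q P. \<rho> p * h p) = l * h q + (1 - l) * (\<Sum>p\<in>P. \<pi> p * h p)"
    using prob_simplex_insert_combination[OF \<open>finite P\<close> \<open>q \<notin> P\<close> l \<pi>] by blast
  have "(\<Sum>p\<in>P. \<pi> p * g p u) = (\<Sum>p\<in>insert q P. \<rho> p * f p u)" for u
  proof -
    have "(\<Sum>p\<in>P. \<pi> p * g p u) = sum \<pi> P * (l * f q u) + (1 - l) * (\<Sum>p\<in>P. \<pi> p * f p u)"
      by (simp add: g_def sum_distrib_left sum_distrib_right distrib_left sum.distrib mult_ac)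
    then show ?thesis
      using \<pi> by (simp only: sum_\<rho>) (simp add: prob_simplex_def)
  qed
  with \<rho> mean_ge show ?case by auto
qed

lemma SUP_ereal_eq_Max:
  assumes "finite P" "P \<noteq> {}"
  shows "(SUP p\<in>P. ereal (f p)) = ereal (MAX p\<in>P. f p)"
proof -
  have "mono ereal" by (simp add: monoI)
  then show ?thesis
    using assms by (simp add: mono_Max_commute image_image Max_Sup)
qed

lemma prob_simplex_minimax:
  fixes R :: "'a \<Rightarrow> 'v::real_vector \<Rightarrow> real"
  assumes P: "finite P" "P \<noteq> {}" and U: "U \<noteq> {}" and convex: "\<And>p. p \<in> P \<Longrightarrow> convex_on U (R p)"
  shows "(SUP \<pi>\<in>prob_simplex P. INF u\<in>U. ereal (\<Sum>p\<in>P. \<pi> p * R p u))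
       = (INF u\<in>U. ereal (MAX p\<in>P. R p u))" (is "?maximin = ?minimax")
proof (rule antisym)
  show "?maximin \<le> ?minimax"
    using P(1) by (intro SUP_least INF_mono) (auto intro: sum_prob_simplex_le_Max)
next
  show "?minimax \<le> ?maximin"
  proof (cases ?minimax)
    case (real c)
    have "c \<le> (MAX p\<in>P. R p u)" if "u \<in> U" for u
      using INF_lower[OF that, of "\<lambda>u. ereal (MAX p\<in>P. R p u)"] real by simp
    then obtain \<pi> where "\<pi> \<in> prob_simplex P" "\<forall>u\<in>U. c \<le> (\<Sum>p\<in>P. \<pi> p * R p u)"
      using convex_on_Max_ge_imp_prob_simplex_ge[OF P U convex, of "\<lambda>p. p" c] by blast
    then show ?thesis
      unfolding real by (intro SUP_upper2[of \<pi>] INF_greatest) auto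
  next
    case PInf
    obtain u where "u \<in> U" using U by blast
    from INF_lower[OF this, of "\<lambda>u. ereal (MAX p\<in>P. R p u)"] PInf show ?thesis by simp
  next
    case MInf
    then show ?thesis by simp
  qed
qed

lemma INF_ereal_eq_INF_epigraph:
  fixes f :: "'a \<Rightarrow> real"
  shows "(INF u\<in>U. ereal (f u)) = (INF (t, u)\<in>{(t, u). u \<in> U \<and> f u \<le> t}. ereal t)"
proof (rule antisym)
  show "(INF u\<in>U. ereal (f u)) \<le> (INF (t, u)\<in>{(t, u). u \<in> U \<and> f u \<le> t}. ereal t)"
    by (rule INF_greatest) (auto intro: INF_lower2)
next
  show "(INF (t, u)\<in>{(t, u). u \<in> U \<and> f u \<le> t}. ereal t) \<le> (INF u\<in>U. ereal (f u))"
  proof (rule INF_greatest)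
    fix u assume "u \<in> U"
    then show "(INF (t, u)\<in>{(t, u). u \<in> U \<and> f u \<le> t}. ereal t) \<le> ereal (f u)"
      by (intro INF_lower2[of "(f u, u)"]) auto
  qed
qed

theorem mainTheorem7:
  fixes P :: "(real ^ 'i) set"
    and U :: "(real ^ 'm) set"
    and R :: "real ^ 'i \<Rightarrow> real ^ 'm \<Rightarrow> real"
  assumes "finite P" and "P \<noteq> {}"
    and "\<And>p i. p \<in> P \<Longrightarrow> 0 \<le> p $ i"
    and "convex U" and "U \<noteq> {}"
    and "\<And>p. p \<in> P \<Longrightarrow> convex_on U (R p)"
  shows "(SUP \<pi>\<in>prob_simplex P. INF u\<in>U. ereal (\<Sum>p\<in>P. \<pi> p * R p u))
           = (INF u\<in>U. SUP p\<in>P. ereal (R p u))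
       \<and> (INF u\<in>U. SUP p\<in>P. ereal (R p u))
           = (INF (t, u)\<in>{(t :: real, u). u \<in> U \<and> (\<forall>p\<in>P. R p u \<le> t)}. ereal t)"
proof -
  have SUP_eq: "(SUP p\<in>P. ereal (R p u)) = ereal (MAX p\<in>P. R p u)" for u
    using assms(1,2) by (rule SUP_ereal_eq_Max)
  have Max_le: "(\<forall>p\<in>P. R p u \<le> t) \<longleftrightarrow> (MAX p\<in>P. R p u) \<le> t" for u t
    using assms(1,2) by simp
  show ?thesis
    unfolding SUP_eq Max_le
    using prob_simplex_minimax[OF assms(1,2,5,6)] INF_ereal_eq_INF_epigraph by (rule conjI)
qed

end
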